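(* Let $g\sim N(0,1)$ and, for $0\le\delta\le1$, let $Z_\delta$ be the centered Gamma difference with parameter $\delta$ (defined in the context). For every real $p\ge4$ and every $0\le\delta\le1$, \[ \mathbb{E}|Z_\delta|^p\le\mathbb{E}|Z_1|^p=\mathbb{E}|g^2-1|^p. \] For every $p>4$ and every $0\le\delta<1$, the inequality is strict.
   Context: $\operatorname{Gamma}(\alpha,\beta)$ denotes the Gamma distribution with shape $\alpha$ and rate $\beta$; a Gamma variable with shape zero is understood to be identically zero. For $-1\le\delta\le1$, let $A$ and $B$ be independent with $A\sim\operatorname{Gamma}(\tfrac14(1+\delta),\tfrac12)$ and $B\sim\operatorname{Gamma}(\tfrac14(1-\delta),\tfrac12)$, and define $Z_\delta=A-B-\delta$. *)

theory Defs
  imports "HOL-Probability.Probability"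
begin

definition gamma_density :: "real \<Rightarrow> real \<Rightarrow> real \<Rightarrow> real" where
  "gamma_density \<alpha> \<beta> x =
     (if x \<le> 0 then 0 else \<beta> powr \<alpha> * x powr (\<alpha> - 1) * exp (- \<beta> * x) / Gamma \<alpha>)"

text \<open>Shape \<open>\<alpha>\<close>, rate \<open>\<beta>\<close>. A variable of shape zero is identically zero, so its law
  is the point mass at 0.\<close>

definition gamma_distribution :: "real \<Rightarrow> real \<Rightarrow> real measure" where
  "gamma_distribution \<alpha> \<beta> =
     (if \<alpha> = 0 then return borel 0 else density lborel (gamma_density \<alpha> \<beta>))"

lemma borel_measurable_gamma_density [measurable]: "gamma_density \<alpha> \<beta> \<in> borel_measurable borel"
  unfolding gamma_density_def[abs_def] by measurable

lemma prob_space_gamma_distribution: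
  assumes "\<alpha> \<ge> 0" "\<beta> > 0"
  shows "prob_space (gamma_distribution \<alpha> \<beta>)"
proof (cases "\<alpha> = 0")
  case True
  then show ?thesis
    by (simp add: gamma_distribution_def prob_space_return)
next
  case False
  with assms have \<alpha>: "\<alpha> > 0" by simp
  have G: "Gamma \<alpha> > 0" using \<alpha> by (rule Gamma_real_pos)
  have "(\<integral>\<^sup>+x. ennreal (gamma_density \<alpha> \<beta> x) \<partial>lborel) =
        (\<integral>\<^sup>+x. ennreal (1 / \<beta>) * ennreal (gamma_density \<alpha> \<beta> (x / \<beta>)) \<partial>lborel)"
    using nn_integral_real_affine[of "\<lambda>x. ennreal (gamma_density \<alpha> \<beta> x)" "1 / \<beta>" 0] assms
    by (simp add: nn_integral_cmult)
  also have "\<dots> = (\<integral>\<^sup>+x. ennreal (1 / Gamma \<alpha>) *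
                 ennreal (indicator {0..} x * x powr (\<alpha> - 1) / exp x) \<partial>lborel)"
  proof (rule nn_integral_cong)
    fix x :: real
    have "1 / \<beta> * gamma_density \<alpha> \<beta> (x / \<beta>) =
          1 / Gamma \<alpha> * (indicator {0..} x * x powr (\<alpha> - 1) / exp x)"
    proof (cases "x > 0")
      case True
      have "\<beta> powr \<alpha> = \<beta> * \<beta> powr (\<alpha> - 1)"
        using assms by (simp add: powr_diff)
      with True G assms show ?thesis
        by (simp add: gamma_density_def powr_divide exp_minus field_simps)
    qed (use assms in \<open>auto simp: gamma_density_def divide_le_0_iff indicator_def\<close>)
    then show "ennreal (1 / \<beta>) * ennreal (gamma_density \<alpha> \<beta> (x / \<beta>)) =
        ennreal (1 / Gamma \<alpha>) * ennreal (indicator {0..} x * x powr (\<alpha> - 1) / exp x)"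
      using assms G by (simp flip: ennreal_mult')
  qed
  also have "\<dots> = ennreal (1 / Gamma \<alpha>) * ennreal (Gamma \<alpha>)"
    using Gamma_conv_nn_integral_real[OF \<alpha>] by (simp add: nn_integral_cmult)
  also have "\<dots> = 1"
    using G by (simp flip: ennreal_mult')
  finally show ?thesis
    using False by (intro prob_spaceI) (simp add: gamma_distribution_def emeasure_density)
qed

definition centered_gamma_difference :: "'a measure \<Rightarrow> real \<Rightarrow> ('a \<Rightarrow> real) \<Rightarrow> bool" where
  "centered_gamma_difference M \<delta> Z \<longleftrightarrow>
     prob_space M \<and> -1 \<le> \<delta> \<and> \<delta> \<le> 1 \<and>
     (\<exists>A B. prob_space.indep_var M borel A borel B \<and>
            distr M borel A = gamma_distribution ((1 + \<delta>) / 4) (1 / 2) \<and>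
            distr M borel B = gamma_distribution ((1 - \<delta>) / 4) (1 / 2) \<and>
            Z = (\<lambda>\<omega>. A \<omega> - B \<omega> - \<delta>))"

end

theory Submission
  imports Defs
begin

text \<open>Let \<open>X\<close>, \<open>Y\<close> be independent centered Gamma variables of shapes \<open>a = (1 + \<delta>) / 4\<close> and
  \<open>b = (1 - \<delta>) / 4\<close>. Then \<open>Z\<^sub>\<delta>\<close> is distributed as \<open>X - Y\<close>, whereas \<open>Z\<^sub>1\<close> is distributed as \<open>X + Y\<close>
  because Gamma shapes add up. So the claim is that the expectation of
  \<open>H X Y = \<bar>X + Y\<bar>\<^sup>p - \<bar>X - Y\<bar>\<^sup>p\<close> is nonnegative. The function \<open>H\<close> is odd in each variable, and for
  \<open>p > 4\<close> the quotient \<open>H x y / (x y)\<close> is strictly supermodular on the positive quadrant (the fourth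
  derivative of \<open>\<bar>z\<bar>\<^sup>p\<close> increases with \<open>\<bar>z\<bar>\<close>). Since \<open>X\<close> and \<open>Y\<close> are centered, \<open>H\<close> may be modified by
  multiples of \<open>x\<close> and of \<open>y\<close> until it has the sign of \<open>(x - m) (y - n)\<close> there, with \<open>m = 2 a\<close>,
  \<open>n = 2 b\<close>. An odd function that changes sign on the positive axis only at the Gamma mean, from
  negative to positive, has nonnegative expectation under the centered law; using this once in each
  variable gives the result. For \<open>p = 4\<close> the modified function is zero.\<close>

subsection \<open>Powers of the absolute value\<close>

lemma has_real_derivative_abs_powr:
  fixes q x :: real
  assumes "q > 1"
  shows "((\<lambda>x. \<bar>x\<bar> powr q) has_real_derivative q * (sgn x * \<bar>x\<bar> powr (q - 1))) (at x)"
proof (cases "x = 0")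
  case True
  \<comment> \<open>At the origin the difference quotient has absolute value
    \<open>\<bar>h\<bar> powr (q - 1)\<close>, which tends to 0 because
    \<open>q > 1\<close>.\<close>
  have "((\<lambda>h. \<bar>h::real\<bar> powr (q - 1)) \<longlongrightarrow> 0) (at 0)"
    using assms by (auto intro!: tendsto_eq_intros tendsto_powr2 simp: eventually_at_filter)
  then have "((\<lambda>h. \<bar>h\<bar> powr q / h) \<longlongrightarrow> 0) (at 0)"
    by (rule Lim_transform_bound[rotated]) (auto simp: eventually_at_filter powr_diff)
  with True show ?thesis
    by (simp add: DERIV_def)
next
  case False
  show ?thesis
  proof (cases "x > 0")
    case True
    have "((\<lambda>x. x powr q) has_real_derivative q * (sgn x * \<bar>x\<bar> powr (q - 1))) (at x)"
      using True by (auto intro!: derivative_eq_intros)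
    then show ?thesis
      by (rule DERIV_cong_ev[THEN iffD1, rotated 3])
         (use True in \<open>auto intro: eventually_mono[OF eventually_nhds_in_open[of "{0<..}"]]\<close>)
  next
    case nonpos: False
    with False have neg: "x < 0" by simp
    have "((\<lambda>x. (- x) powr q) has_real_derivative q * (sgn x * \<bar>x\<bar> powr (q - 1))) (at x)"
      using neg by (auto intro!: derivative_eq_intros)
    then show ?thesis
      by (rule DERIV_cong_ev[THEN iffD1, rotated 3])
         (use neg in \<open>auto intro: eventually_mono[OF eventually_nhds_in_open[of "{..<0}"]]\<close>)
  qed
qed

lemma has_real_derivative_sgn_abs_powr:
  fixes r x :: real
  assumes "r > 1"
  shows "((\<lambda>x. sgn x * \<bar>x\<bar> powr r) has_real_derivative r * \<bar>x\<bar> powr (r - 1)) (at x)"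
proof (cases "x = 0")
  case True
  have "((\<lambda>h. \<bar>h::real\<bar> powr (r - 1)) \<longlongrightarrow> 0) (at 0)"
    using assms by (auto intro!: tendsto_eq_intros tendsto_powr2 simp: eventually_at_filter)
  then have "((\<lambda>h. sgn h * \<bar>h\<bar> powr r / h) \<longlongrightarrow> 0) (at 0)"
    by (rule Lim_transform_bound[rotated])
       (auto simp: eventually_at_filter powr_diff abs_mult sgn_if)
  with True show ?thesis
    by (simp add: DERIV_def)
next
  case False
  then have ev: "\<forall>\<^sub>F y in nhds x. sgn x * \<bar>y\<bar> powr r = sgn y * \<bar>y\<bar> powr r"
    by (cases "x > 0")
       (auto intro: eventually_mono[OF eventually_nhds_in_open[of "{0<..}"]]
                    eventually_mono[OF eventually_nhds_in_open[of "{..<0}"]])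
  have "((\<lambda>y. sgn x * \<bar>y\<bar> powr r) has_real_derivative r * \<bar>x\<bar> powr (r - 1)) (at x)"
    by (rule DERIV_cong[OF DERIV_cmult[OF has_real_derivative_abs_powr[OF assms]]])
       (use False in \<open>simp add: sgn_if\<close>)
  then show ?thesis
    using DERIV_cong_ev[OF refl ev refl] by simp
qed

text \<open>Strict convexity makes the slope of the chord from the origin increase; the mean value
  theorem on the two adjacent intervals compares the slopes. The form is cross-multiplied to avoid
  division. Positivity of \<open>f''\<close> is asked only for \<open>x > 0\<close> because in the
  applications \<open>f''\<close> vanishes at 0.\<close>

lemma strictly_convex_ratio_mono:
  fixes f f' f'' :: "real \<Rightarrow> real"
  assumes f: "\<And>x. (f has_real_derivative f' x) (at x)"
    and f': "\<And>x. (f' has_real_derivative f'' x) (at x)"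
    and pos: "\<And>x. x > 0 \<Longrightarrow> f'' x > 0"
    and "f 0 = 0" "0 < x" "x < y"
  shows "f x * y < f y * x"
proof -
  obtain u where u: "0 < u" "u < x" "f x - f 0 = (x - 0) * f' u"
    using MVT2[of 0 x f f'] f \<open>0 < x\<close> by blast
  obtain v where v: "x < v" "v < y" "f y - f x = (y - x) * f' v"
    using MVT2[of x y f f'] f \<open>x < y\<close> by blast
  have "f' u < f' v"
  proof (rule DERIV_pos_imp_increasing[where f = f'])
    show "u < v" using u v by simp
    show "\<exists>D. (f' has_real_derivative D) (at z) \<and> D > 0" if "u \<le> z" "z \<le> v" for z
      using f'[of z] pos[of z] u that by auto
  qed
  then have "(y - x) * x * f' u < (y - x) * x * f' v"
    using \<open>0 < x\<close> \<open>x < y\<close> by simp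
  moreover have fx: "f x = x * f' u" and fy: "f y = x * f' u + (y - x) * f' v"
    using u v \<open>f 0 = 0\<close> by simp_all
  ultimately show ?thesis
    unfolding fx fy by (simp add: algebra_simps)
qed

subsection \<open>Supermodularity of \<open>(\<bar>x + y\<bar>\<^sup>p - \<bar>x - y\<bar>\<^sup>p) / (x y)\<close>\<close>

definition powr_gap :: "real \<Rightarrow> real \<Rightarrow> real \<Rightarrow> real" where
  "powr_gap p x y = \<bar>x + y\<bar> powr p - \<bar>x - y\<bar> powr p"

lemma powr_gap_minus [simp]:
  "powr_gap p (- x) y = - powr_gap p x y" "powr_gap p x (- y) = - powr_gap p x y"
  using abs_minus_commute[of x y] abs_minus_cancel[of "x + y"] by (simp_all add: powr_gap_def)

lemma powr_gap_0 [simp]: "powr_gap p 0 y = 0" "powr_gap p x 0 = 0"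
  by (simp_all add: powr_gap_def)

lemma borel_measurable_powr_gap [measurable (raw)]:
  assumes [measurable]: "f \<in> borel_measurable M" "g \<in> borel_measurable M"
  shows "(\<lambda>x. powr_gap p (f x) (g x)) \<in> borel_measurable M"
  unfolding powr_gap_def by measurable

lemma powr_gap_commute: "powr_gap p x y = powr_gap p y x"
  by (simp add: powr_gap_def abs_minus_commute add.commute)

text \<open>Two derivatives reproduce the gap with exponent lowered by 2. Convexity statements for
  \<open>p\<close> thus reduce to positivity or monotonicity for \<open>p - 2\<close>.\<close>

lemma powr_gap_second_derivative:
  assumes "p > 2"
  defines "D \<equiv> \<lambda>x y. p * (sgn (x + y) * \<bar>x + y\<bar> powr (p - 1) + sgn (x - y) * \<bar>x - y\<bar> powr (p - 1))"
  shows "((\<lambda>y. powr_gap p x y) has_real_derivative D x y) (at y)"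
    and "((\<lambda>y. D x y) has_real_derivative p * (p - 1) * powr_gap (p - 2) x y) (at y)"
proof -
  have 1: "((\<lambda>y. \<bar>x + y\<bar> powr p) has_real_derivative p * (sgn (x + y) * \<bar>x + y\<bar> powr (p - 1))) (at y)"
    by (rule DERIV_cong, rule DERIV_chain2[where g = "\<lambda>y. x + y"], rule has_real_derivative_abs_powr)
       (use assms in \<open>auto intro!: derivative_eq_intros\<close>)
  have 2: "((\<lambda>y. \<bar>x - y\<bar> powr p) has_real_derivative - (p * (sgn (x - y) * \<bar>x - y\<bar> powr (p - 1)))) (at y)"
    by (rule DERIV_cong, rule DERIV_chain2[where g = "\<lambda>y. x - y"], rule has_real_derivative_abs_powr)
       (use assms in \<open>auto intro!: derivative_eq_intros\<close>)
  show "((\<lambda>y. powr_gap p x y) has_real_derivative D x y) (at y)"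
    unfolding powr_gap_def D_def
    by (rule DERIV_cong[OF DERIV_diff[OF 1 2]]) (simp add: algebra_simps)
  have 3: "((\<lambda>y. sgn (x + y) * \<bar>x + y\<bar> powr (p - 1)) has_real_derivative (p - 1) * \<bar>x + y\<bar> powr (p - 1 - 1)) (at y)"
    by (rule DERIV_cong, rule DERIV_chain2[where g = "\<lambda>y. x + y"], rule has_real_derivative_sgn_abs_powr)
       (use assms in \<open>auto intro!: derivative_eq_intros\<close>)
  have 4: "((\<lambda>y. sgn (x - y) * \<bar>x - y\<bar> powr (p - 1)) has_real_derivative - ((p - 1) * \<bar>x - y\<bar> powr (p - 1 - 1))) (at y)"
    by (rule DERIV_cong, rule DERIV_chain2[where g = "\<lambda>y. x - y"], rule has_real_derivative_sgn_abs_powr)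
       (use assms in \<open>auto intro!: derivative_eq_intros\<close>)
  show "((\<lambda>y. D x y) has_real_derivative p * (p - 1) * powr_gap (p - 2) x y) (at y)"
    unfolding powr_gap_def D_def
    by (rule DERIV_cong[OF DERIV_cmult[OF DERIV_add[OF 3 4]]]) (simp add: algebra_simps)
qed

lemma powr_gap_pos:
  assumes "p > 0" "x > 0" "y > 0"
  shows "powr_gap p x y > 0"
  using assms by (auto simp: powr_gap_def intro!: powr_less_mono2)

lemma powr_gap_ratio_mono:
  assumes "p > 2" "y > 0" "0 < s" "s < t"
  shows "powr_gap p s y * t < powr_gap p t y * s"
proof -
  have "p * (p - 1) * powr_gap (p - 2) y x > 0" if "x > 0" for x
    using assms that by (simp add: powr_gap_pos)
  from strictly_convex_ratio_mono[OF powr_gap_second_derivative[OF \<open>p > 2\<close>] this _ \<open>0 < s\<close> \<open>s < t\<close>]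
  show ?thesis by (simp add: powr_gap_commute[of p y])
qed

text \<open>The function \<open>powr_gap p t y * s - powr_gap p s y * t\<close> of \<open>y\<close>
  vanishes at 0. Its second derivative is a positive multiple of the same expression for
  \<open>p - 2\<close>, which is positive by \<open>powr_gap_ratio_mono\<close>. That lemma needs
  \<open>p - 2 > 2\<close>, which is where \<open>p > 4\<close> enters.\<close>

lemma powr_gap_ratio_supermodular:
  assumes "p > 4" "0 < s" "s < t" "0 < u" "u < v"
  shows "(powr_gap p t u * s - powr_gap p s u * t) * v < (powr_gap p t v * s - powr_gap p s v * t) * u"
proof -
  have p: "p > 2" using assms by simp
  note D = powr_gap_second_derivative[OF p]
  have *: "p * (p - 1) * powr_gap (p - 2) t y * s - p * (p - 1) * powr_gap (p - 2) s y * t > 0"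
    if "y > 0" for y
  proof -
    have "p * (p - 1) * (powr_gap (p - 2) t y * s - powr_gap (p - 2) s y * t) > 0"
      using powr_gap_ratio_mono[of "p - 2" y s t] assms that by (intro mult_pos_pos) simp_all
    then show ?thesis by (simp add: algebra_simps)
  qed
  show ?thesis
    by (rule strictly_convex_ratio_mono
          [where f = "\<lambda>y. powr_gap p t y * s - powr_gap p s y * t",
           OF DERIV_diff[OF DERIV_cmult_right[OF D(1)] DERIV_cmult_right[OF D(1)]]
              DERIV_diff[OF DERIV_cmult_right[OF D(2)] DERIV_cmult_right[OF D(2)]] *])
       (use assms in auto)
qed

text \<open>\<open>m n\<close> times \<open>powr_gap\<close>, corrected by multiples of \<open>x\<close>, of \<open>y\<close> and of \<open>x y\<close> so that it
  vanishes for \<open>x = m\<close> and for \<open>y = n\<close>. The corrections integrate to zero against centered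
  variables.\<close>

definition gap_remainder :: "real \<Rightarrow> real \<Rightarrow> real \<Rightarrow> real \<Rightarrow> real \<Rightarrow> real" where
  "gap_remainder p m n x y =
     n * (m * powr_gap p x y - x * powr_gap p m y) - y * (m * powr_gap p x n - x * powr_gap p m n)"

lemma gap_remainder_minus [simp]:
  "gap_remainder p m n x (- y) = - gap_remainder p m n x y"
  by (simp add: gap_remainder_def algebra_simps)

lemma gap_remainder_eq_0 [simp]: "gap_remainder p m n x n = 0"
  by (simp add: gap_remainder_def algebra_simps)

text \<open>With \<open>q x y = powr_gap p x y / (x * y)\<close>, the remainder divided by
  \<open>m * n * x * y\<close> is the mixed difference \<open>q x y - q m y - q x n + q m n\<close>.
  Supermodularity of \<open>q\<close> gives its sign; the four cases order the corners of the
  rectangle.\<close>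

lemma gap_remainder_pos:
  assumes "p > 4" "m > 0" "n > 0" "x > 0" "y > 0" "x \<noteq> m" "y \<noteq> n"
  shows "gap_remainder p m n x y * (x - m) * (y - n) > 0"
proof (cases "x < m"; cases "y < n")
  assume "x < m" "y < n"
  with powr_gap_ratio_supermodular[of p x m y n] assms
  have "gap_remainder p m n x y > 0" by (simp add: gap_remainder_def algebra_simps)
  with \<open>x < m\<close> \<open>y < n\<close> show ?thesis by (simp add: mult_less_0_iff zero_less_mult_iff)
next
  assume "x < m" "\<not> y < n"
  with powr_gap_ratio_supermodular[of p x m n y] assms
  have "gap_remainder p m n x y < 0" by (simp add: gap_remainder_def algebra_simps)
  with \<open>x < m\<close> \<open>\<not> y < n\<close> assms show ?thesis by (simp add: mult_less_0_iff zero_less_mult_iff)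
next
  assume "\<not> x < m" "y < n"
  with powr_gap_ratio_supermodular[of p m x y n] assms
  have "gap_remainder p m n x y < 0" by (simp add: gap_remainder_def algebra_simps)
  with \<open>\<not> x < m\<close> \<open>y < n\<close> assms show ?thesis by (simp add: mult_less_0_iff zero_less_mult_iff)
next
  assume "\<not> x < m" "\<not> y < n"
  with powr_gap_ratio_supermodular[of p m x n y] assms
  have "gap_remainder p m n x y > 0" by (simp add: gap_remainder_def algebra_simps)
  with \<open>\<not> x < m\<close> \<open>\<not> y < n\<close> assms show ?thesis by (simp add: mult_less_0_iff zero_less_mult_iff)
qed

lemma powr_gap_4: "powr_gap 4 x y = 8 * x ^ 3 * y + 8 * x * y ^ 3"
proof -
  have *: "\<bar>z\<bar> powr 4 = z ^ 4" for z :: real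
    by (cases "z = 0") (simp_all add: powr_numeral)
  show ?thesis
    unfolding powr_gap_def * by (simp add: power4_eq_xxxx power3_eq_cube algebra_simps)
qed

text \<open>For \<open>p = 4\<close> the quotient of the gap by \<open>x * y\<close> is
  \<open>8 * x^2 + 8 * y^2\<close>, a function of \<open>x\<close> plus a function of
  \<open>y\<close>, so its mixed difference vanishes.\<close>

lemma gap_remainder_4: "gap_remainder 4 m n x y = 0"
  by (simp add: gap_remainder_def powr_gap_4 algebra_simps)

text \<open>A crude bound from
  \<open>\<bar>x + y\<bar> \<le> 2 * max \<bar>x\<bar> \<bar>y\<bar>\<close>; it serves only to
  dominate integrands.\<close>

lemma abs_add_powr_le:
  fixes x y q :: real
  assumes "q \<ge> 0"
  shows "\<bar>x + y\<bar> powr q \<le> 2 powr q * (\<bar>x\<bar> powr q + \<bar>y\<bar> powr q)"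
proof -
  have "\<bar>x + y\<bar> powr q \<le> (2 * max \<bar>x\<bar> \<bar>y\<bar>) powr q"
    using assms by (intro powr_mono2) auto
  also have "\<dots> = 2 powr q * (max \<bar>x\<bar> \<bar>y\<bar>) powr q"
    by (simp add: powr_mult)
  also have "\<dots> \<le> 2 powr q * (\<bar>x\<bar> powr q + \<bar>y\<bar> powr q)"
    by (intro mult_left_mono) (auto simp: max_def)
  finally show ?thesis .
qed

subsection \<open>Centered Gamma laws\<close>

lemma gamma_density_nonneg [simp]: "\<alpha> > 0 \<Longrightarrow> gamma_density \<alpha> \<beta> x \<ge> 0"
  by (simp add: gamma_density_def Gamma_real_pos less_imp_le)

lemma gamma_density_pos: "\<alpha> > 0 \<Longrightarrow> \<beta> > 0 \<Longrightarrow> x > 0 \<Longrightarrow> gamma_density \<alpha> \<beta> x > 0"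
  by (simp add: gamma_density_def Gamma_real_pos)

text \<open>For shape at most 1 the power factor is nonincreasing; strictness comes from the
  exponential, so shape 1 is included.\<close>

lemma gamma_density_strict_antimono:
  assumes "0 < \<alpha>" "\<alpha> \<le> 1" "\<beta> > 0" "0 < x" "x < y"
  shows "gamma_density \<alpha> \<beta> y < gamma_density \<alpha> \<beta> x"
proof -
  have "y powr (\<alpha> - 1) \<le> x powr (\<alpha> - 1)"
    using assms by (intro powr_mono2') auto
  then have "y powr (\<alpha> - 1) * exp (- \<beta> * y) < x powr (\<alpha> - 1) * exp (- \<beta> * x)"
    using assms by (intro mult_le_less_imp_less) auto
  then have "\<beta> powr \<alpha> * (y powr (\<alpha> - 1) * exp (- \<beta> * y)) / Gamma \<alpha> <
      \<beta> powr \<alpha> * (x powr (\<alpha> - 1) * exp (- \<beta> * x)) / Gamma \<alpha>"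
    using assms by (intro divide_strict_right_mono mult_strict_left_mono) (auto simp: Gamma_real_pos)
  then show ?thesis
    using assms by (simp add: gamma_density_def mult.assoc)
qed

lemma has_bochner_integral_gamma_density:
  assumes "\<alpha> > 0" "\<beta> > 0"
  shows "has_bochner_integral lborel (gamma_density \<alpha> \<beta>) 1"
proof (rule has_bochner_integral_nn_integral)
  interpret prob_space "gamma_distribution \<alpha> \<beta>"
    using assms by (intro prob_space_gamma_distribution) auto
  show "(\<integral>\<^sup>+x. gamma_density \<alpha> \<beta> x \<partial>lborel) = ennreal 1"
    using emeasure_space_1 assms by (simp add: gamma_distribution_def emeasure_density)
qed (use assms in auto)

text \<open>Weighting by a power only shifts the shape, so every moment follows from the
  normalization of another Gamma density.\<close>

lemma gamma_density_powr:
  assumes "\<alpha> > 0" "\<beta> > 0" "q \<ge> 0"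
  shows "gamma_density \<alpha> \<beta> x * \<bar>x\<bar> powr q =
    Gamma (\<alpha> + q) / (Gamma \<alpha> * \<beta> powr q) * gamma_density (\<alpha> + q) \<beta> x"
proof (cases "x > 0")
  case True
  have "Gamma \<alpha> \<noteq> 0" "Gamma (\<alpha> + q) \<noteq> 0"
    using assms Gamma_real_pos[of \<alpha>] Gamma_real_pos[of "\<alpha> + q"] by linarith+
  moreover have "x powr (\<alpha> + q - 1) = x powr (\<alpha> - 1) * x powr q"
    by (simp add: algebra_simps flip: powr_add)
  ultimately show ?thesis
    using True assms by (simp add: gamma_density_def powr_add)
qed (simp add: gamma_density_def)

lemma has_bochner_integral_gamma_density_powr:
  assumes "\<alpha> > 0" "\<beta> > 0" "q \<ge> 0"
  shows "has_bochner_integral lborel (\<lambda>x. gamma_density \<alpha> \<beta> x * \<bar>x\<bar> powr q)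
           (Gamma (\<alpha> + q) / (Gamma \<alpha> * \<beta> powr q))"
  using has_bochner_integral_mult_right[OF has_bochner_integral_gamma_density[of "\<alpha> + q" \<beta>],
      of "Gamma (\<alpha> + q) / (Gamma \<alpha> * \<beta> powr q)"] assms
  by (simp add: gamma_density_powr)

lemma sets_gamma_distribution [simp, measurable_cong]: "sets (gamma_distribution \<alpha> \<beta>) = sets borel"
  by (simp add: gamma_distribution_def)

lemma space_gamma_distribution [simp]: "space (gamma_distribution \<alpha> \<beta>) = UNIV"
  by (simp add: gamma_distribution_def)

text \<open>At rate 1/2 the mean is \<open>2 * \<alpha>\<close>. Shape 0 is kept, as a point mass at
  0, for the sake of \<delta> = 1.\<close>

definition centered_gamma :: "real \<Rightarrow> real measure" where
  "centered_gamma \<alpha> = distr (gamma_distribution \<alpha> (1 / 2)) borel (\<lambda>x. x - 2 * \<alpha>)"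

lemma sets_centered_gamma [simp, measurable_cong]: "sets (centered_gamma \<alpha>) = sets borel"
  by (simp add: centered_gamma_def)

lemma space_centered_gamma [simp]: "space (centered_gamma \<alpha>) = UNIV"
  by (simp add: centered_gamma_def)

lemma prob_space_centered_gamma: "\<alpha> \<ge> 0 \<Longrightarrow> prob_space (centered_gamma \<alpha>)"
  unfolding centered_gamma_def
  by (intro prob_space.prob_space_distr prob_space_gamma_distribution) auto

lemma centered_gamma_0: "centered_gamma 0 = return borel 0"
  by (simp add: centered_gamma_def gamma_distribution_def distr_return)

lemma centered_gamma_eq_density:
  assumes "\<alpha> > 0"
  shows "centered_gamma \<alpha> = density lborel (\<lambda>x. gamma_density \<alpha> (1 / 2) (x + 2 * \<alpha>))"
proof -
  have "density (distr lborel borel (\<lambda>x. - (2 * \<alpha>) + x)) (\<lambda>x. gamma_density \<alpha> (1 / 2) (x + 2 * \<alpha>)) =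
      distr (density lborel (gamma_density \<alpha> (1 / 2))) borel (\<lambda>x. - (2 * \<alpha>) + x)"
    by (subst density_distr) (auto simp: add.commute)
  moreover have "distr lborel borel (\<lambda>x. - (2 * \<alpha>) + x) = lborel"
    by (rule lborel_distr_plus)
  ultimately show ?thesis
    using assms by (simp add: centered_gamma_def gamma_distribution_def)
qed

lemma integrable_centered_gamma_powr:
  assumes "\<alpha> \<ge> 0" "q \<ge> 0"
  shows "integrable (centered_gamma \<alpha>) (\<lambda>x. \<bar>x\<bar> powr q)"
proof (cases "\<alpha> = 0")
  case True
  interpret prob_space "centered_gamma 0" by (rule prob_space_centered_gamma) simp
  \<comment> \<open>The integrand vanishes at the atom 0 even for \<open>q = 0\<close>, since
    \<open>0 powr 0 = 0\<close>.\<close>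
  have "AE x in centered_gamma 0. norm (\<bar>x\<bar> powr q) \<le> 0"
    unfolding centered_gamma_0 by (subst AE_return) auto
  then show ?thesis
    using True by (auto intro!: integrable_const_bound)
next
  case False
  with assms have \<alpha>: "\<alpha> > 0" by simp
  interpret prob_space "gamma_distribution \<alpha> (1 / 2)"
    using \<alpha> by (intro prob_space_gamma_distribution) auto
  have "integrable (gamma_distribution \<alpha> (1 / 2)) (\<lambda>x. \<bar>x\<bar> powr q)"
    using has_bochner_integral_gamma_density_powr[of \<alpha> "1 / 2" q] \<alpha> assms
    by (simp add: gamma_distribution_def integrable_real_density has_bochner_integral_iff)
  then have "integrable (gamma_distribution \<alpha> (1 / 2))
      (\<lambda>x. 2 powr q * (\<bar>x\<bar> powr q + \<bar>2 * \<alpha>\<bar> powr q))"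
    by auto
  then have "integrable (gamma_distribution \<alpha> (1 / 2)) (\<lambda>x. \<bar>x - 2 * \<alpha>\<bar> powr q)"
    by (rule Bochner_Integration.integrable_bound)
       (use abs_add_powr_le[OF \<open>q \<ge> 0\<close>, of _ "- (2 * \<alpha>)"] in auto)
  then show ?thesis
    by (simp add: centered_gamma_def integrable_distr_eq)
qed

lemma has_bochner_integral_centered_gamma:
  assumes "\<alpha> > 0"
  shows "has_bochner_integral (centered_gamma \<alpha>) (\<lambda>x. x) 0"
proof -
  interpret prob_space "gamma_distribution \<alpha> (1 / 2)"
    using assms by (intro prob_space_gamma_distribution) auto
  have eq: "(\<lambda>x. gamma_density \<alpha> (1 / 2) x * \<bar>x\<bar> powr 1) = (\<lambda>x. gamma_density \<alpha> (1 / 2) x * x)"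
    by (auto simp: gamma_density_def)
  have "Gamma (\<alpha> + 1) / (Gamma \<alpha> * (1 / 2) powr 1) = 2 * \<alpha>"
  proof -
    have "Gamma \<alpha> \<noteq> 0" using Gamma_real_pos[OF assms] by linarith
    moreover have "Gamma (\<alpha> + 1) = \<alpha> * Gamma \<alpha>"
      using assms by (intro Gamma_plus1) (auto simp: nonpos_Ints_def)
    ultimately show ?thesis by simp
  qed
  then have "has_bochner_integral lborel (\<lambda>x. gamma_density \<alpha> (1 / 2) x * x) (2 * \<alpha>)"
    using has_bochner_integral_gamma_density_powr[of \<alpha> "1 / 2" 1] assms unfolding eq by simp
  then have "has_bochner_integral (gamma_distribution \<alpha> (1 / 2)) (\<lambda>x. x) (2 * \<alpha>)"
    using assms by (auto simp: gamma_distribution_def intro!: has_bochner_integral_density)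
  then have "has_bochner_integral (gamma_distribution \<alpha> (1 / 2)) (\<lambda>x. x - 2 * \<alpha>) (2 * \<alpha> - 2 * \<alpha>)"
    by (intro has_bochner_integral_diff) (auto simp: has_bochner_integral_iff prob_space[simplified])
  then show ?thesis
    by (simp add: centered_gamma_def has_bochner_integral_iff integrable_distr_eq integral_distr)
qed

section \<open>Additivity of Gamma shapes under convolution\<close>

lemma gamma_density_convolution:
  assumes "a > 0" "b > 0" "\<beta> > 0"
  shows "(\<integral>\<^sup>+y. ennreal (gamma_density a \<beta> (x - y)) * ennreal (gamma_density b \<beta> y) \<partial>lborel) =
    ennreal (gamma_density (a + b) \<beta> x)"
proof (cases "x > 0")
  case False
  then have "ennreal (gamma_density a \<beta> (x - y)) * ennreal (gamma_density b \<beta> y) = 0" for y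
    by (auto simp: gamma_density_def)
  then have "(\<lambda>y. ennreal (gamma_density a \<beta> (x - y)) * ennreal (gamma_density b \<beta> y)) = (\<lambda>y. 0)"
    by (intro ext)
  then show ?thesis using False by (simp add: gamma_density_def)
next
  case True
  have pos: "Gamma a > 0" "Gamma b > 0" "Gamma (a + b) > 0"
    using assms by (auto intro: Gamma_real_pos)
  then have nz: "Gamma a \<noteq> 0" "Gamma b \<noteq> 0" "Gamma (a + b) \<noteq> 0"
    by linarith+
  have Beta: "Beta b a = Gamma b * Gamma a / Gamma (a + b)"
    by (simp add: Beta_def add.commute)
  then have Bpos: "Beta b a > 0" using pos by simp
  have "((\<lambda>t. t powr (b - 1) * (1 - t) powr (a - 1)) has_integral Beta b a) {0<..<1}"
    using has_integral_Beta_real[of b a] assms by (simp add: has_integral_Icc_iff_Ioo)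
  then have I: "(\<integral>\<^sup>+t. ennreal (indicator {0<..<1} t * (t powr (b - 1) * (1 - t) powr (a - 1))) \<partial>lborel) =
      ennreal (Beta b a)"
    by (intro nn_integral_has_integral_lebesgue[symmetric, THEN sym]) auto
  \<comment> \<open>After the substitution \<open>y = x * t\<close> the exponentials combine and the
    powers of \<open>x\<close> factor out, leaving the Beta integrand; outside
    \<open>0 < t < 1\<close> one of the two densities vanishes.\<close>
  have *: "x * (gamma_density a \<beta> (x - x * t) * gamma_density b \<beta> (x * t)) =
      gamma_density (a + b) \<beta> x / Beta b a *
        (indicator {0<..<1} t * (t powr (b - 1) * (1 - t) powr (a - 1)))" for t
  proof (cases "0 < t \<and> t < 1")
    case t: True
    have x: "x - x * t = x * (1 - t)" by (simp add: algebra_simps)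
    have "x powr (a + b - 1) = x * (x powr (a - 1) * x powr (b - 1))"
      using True by (simp add: powr_diff powr_add)
    moreover have "exp (- \<beta> * x) = exp (- \<beta> * (x * (1 - t))) * exp (- \<beta> * (x * t))"
      by (simp add: algebra_simps flip: exp_add)
    moreover have "\<not> x * (1 - t) \<le> 0" "\<not> x * t \<le> 0"
      using t True by (simp_all add: not_le)
    ultimately show ?thesis
      using t True nz unfolding x Beta
      by (simp add: gamma_density_def powr_add powr_mult mult_ac)
  next
    case t: False
    then have "x * t \<le> 0 \<or> x - x * t \<le> 0"
      using True by (auto simp: mult_le_0_iff)
    then show ?thesis using t by (auto simp: gamma_density_def)
  qed
  have "(\<integral>\<^sup>+y. ennreal (gamma_density a \<beta> (x - y)) * ennreal (gamma_density b \<beta> y) \<partial>lborel) =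
      ennreal \<bar>x\<bar> * (\<integral>\<^sup>+t. ennreal (gamma_density a \<beta> (x - (0 + x * t))) *
         ennreal (gamma_density b \<beta> (0 + x * t)) \<partial>lborel)"
    using True by (intro nn_integral_real_affine) auto
  also have "\<dots> = (\<integral>\<^sup>+t. ennreal (gamma_density (a + b) \<beta> x / Beta b a) *
       ennreal (indicator {0<..<1} t * (t powr (b - 1) * (1 - t) powr (a - 1))) \<partial>lborel)"
    using True assms Bpos
    by (subst nn_integral_cmult[symmetric]) (auto simp: * simp flip: ennreal_mult' ennreal_mult'' intro!: nn_integral_cong)
  also have "\<dots> = ennreal (gamma_density (a + b) \<beta> x / Beta b a) * ennreal (Beta b a)"
    by (subst nn_integral_cmult) (auto simp: I)
  also have "\<dots> = ennreal (gamma_density (a + b) \<beta> x)"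
    using Bpos assms by (simp flip: ennreal_mult')
  finally show ?thesis .
qed

text \<open>This covers shape 0 in the additivity of shapes, where the law has no density.\<close>

lemma convolution_return_0:
  fixes N :: "real measure"
  assumes "prob_space N" and [simp, measurable_cong]: "sets N = sets borel"
  shows "return borel 0 \<star> N = N"
proof (rule measure_eqI)
  fix A assume [measurable]: "A \<in> sets (return borel 0 \<star> N)"
  interpret N: prob_space N by fact
  have [simp]: "space N = UNIV" using sets_eq_imp_space_eq[of N borel] by simp
  have A: "A \<in> sets borel" using \<open>A \<in> _\<close> by simp
  have "emeasure (return borel 0 \<star> N) A = (\<integral>\<^sup>+x. emeasure N {a. a + x \<in> A} \<partial>return borel 0)"
    using A by (intro convolution_emeasure)
      (auto intro: N.finite_measure_axioms prob_space.finite_measure[OF prob_space_return])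
  also have "\<dots> = (\<integral>\<^sup>+x. \<integral>\<^sup>+y. indicator A (y + x) \<partial>N \<partial>return borel 0)"
  proof (intro nn_integral_cong)
    fix x :: real
    have "{a. a + x \<in> A} \<in> sets N" using A by measurable
    then have "emeasure N {a. a + x \<in> A} = (\<integral>\<^sup>+y. indicator {a. a + x \<in> A} y \<partial>N)"
      by simp
    then show "emeasure N {a. a + x \<in> A} = (\<integral>\<^sup>+y. indicator A (y + x) \<partial>N)"
      by (simp add: indicator_def)
  qed
  also have "\<dots> = emeasure N A"
    using A by (subst nn_integral_return) (auto intro!: N.borel_measurable_nn_integral)
  finally show "emeasure (return borel 0 \<star> N) A = emeasure N A" .
qed simp

lemma convolution_gamma_distribution:
  assumes "a \<ge> 0" "b \<ge> 0" "\<beta> > 0"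
  shows "gamma_distribution a \<beta> \<star> gamma_distribution b \<beta> = gamma_distribution (a + b) \<beta>"
proof -
  note P = prob_space_gamma_distribution[OF _ \<open>\<beta> > 0\<close>]
  have fin: "finite_measure (gamma_distribution c \<beta>)" if "c \<ge> 0" for c
    using P[OF that] by (rule prob_space.finite_measure)
  consider "a = 0" | "b = 0" | "a > 0" "b > 0" using assms by linarith
  then show ?thesis
  proof cases
    case 1
    then show ?thesis
      using convolution_return_0[OF P[OF \<open>b \<ge> 0\<close>]] by (simp add: gamma_distribution_def)
  next
    case 2
    have "gamma_distribution a \<beta> \<star> gamma_distribution 0 \<beta> =
        (gamma_distribution 0 \<beta> \<star> gamma_distribution a \<beta>)"
      using fin assms by (intro convolution_commutative) auto
    also have "\<dots> = (return borel 0 \<star> gamma_distribution a \<beta>)"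
      by (simp add: gamma_distribution_def)
    also have "\<dots> = gamma_distribution a \<beta>"
      by (rule convolution_return_0[OF P[OF \<open>a \<ge> 0\<close>]]) simp
    finally show ?thesis using 2 by simp
  next
    case 3
    then show ?thesis
      using fin[of a] fin[of b] assms
      by (simp add: gamma_distribution_def convolution_density gamma_density_convolution)
  qed
qed

text \<open>The density of a Gamma law of shape at most 1 decreases on the positive axis, so
  \<open>k x - k (- x)\<close>, where \<open>k\<close> is the density of the centered law, changes sign on the positive
  axis exactly once, at the mean \<open>2 \<alpha>\<close>.\<close>

lemma centered_gamma_integral_sign_change:
  assumes \<alpha>: "0 < \<alpha>" "\<alpha> \<le> 1"
    and int: "integrable (centered_gamma \<alpha>) \<eta>"
    and odd: "\<And>x. \<eta> (- x) = - \<eta> x"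
    and sign: "\<And>x. x > 0 \<Longrightarrow> \<eta> x * (x - 2 * \<alpha>) \<ge> 0"
  shows "(\<integral>x. \<eta> x \<partial>centered_gamma \<alpha>) \<ge> 0"
    and "(\<And>x. x > 0 \<Longrightarrow> x \<noteq> 2 * \<alpha> \<Longrightarrow> \<eta> x \<noteq> 0) \<Longrightarrow> (\<integral>x. \<eta> x \<partial>centered_gamma \<alpha>) > 0"
proof -
  define k where "k x = gamma_density \<alpha> (1 / 2) (x + 2 * \<alpha>)" for x
  have k_meas [measurable]: "k \<in> borel_measurable borel" unfolding k_def by measurable
  have k_nonneg: "k x \<ge> 0" for x using \<alpha> by (simp add: k_def)
  have [measurable]: "\<eta> \<in> borel_measurable borel"
    using borel_measurable_integrable[OF int] by simp
  have cg: "centered_gamma \<alpha> = density lborel k"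
    using \<alpha> by (simp add: centered_gamma_eq_density k_def)
  have int1: "integrable lborel (\<lambda>x. k x * \<eta> x)"
    using int k_nonneg by (simp add: cg integrable_real_density)
  have int2: "integrable lborel (\<lambda>x. k (- x) * \<eta> x)"
    using lborel_integrable_real_affine[OF int1, of "-1" 0] by (simp add: odd)
  have "(\<integral>x. \<eta> x \<partial>centered_gamma \<alpha>) = (\<integral>x. k x * \<eta> x \<partial>lborel)"
    using k_nonneg by (simp add: cg integral_real_density)
  \<comment> \<open>Reflection together with oddness of \<open>\<eta>\<close> moves the sign onto
    the weight. Adding both forms of the integral gives the weight
    \<open>k x - k (- x)\<close>.\<close>
  moreover have "(\<integral>x. k x * \<eta> x \<partial>lborel) = - (\<integral>x. k (- x) * \<eta> x \<partial>lborel)"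
    using lborel_integral_real_affine[of "-1" "\<lambda>x. k x * \<eta> x" 0] by (simp add: odd)
  ultimately have eq: "2 * (\<integral>x. \<eta> x \<partial>centered_gamma \<alpha>) = (\<integral>x. (k x - k (- x)) * \<eta> x \<partial>lborel)"
    using int1 int2 by (simp add: left_diff_distrib)
  have k1: "k x < k (- x)" if "0 < x" "x < 2 * \<alpha>" for x
    unfolding k_def using \<alpha> that by (intro gamma_density_strict_antimono) auto
  \<comment> \<open>Beyond the mean, the reflected point has left the support of the law.\<close>
  have k2: "k x > 0" "k (- x) = 0" if "x > 2 * \<alpha>" for x
    unfolding k_def using \<alpha> that by (auto intro: gamma_density_pos) (simp add: gamma_density_def)
  have pos_nonneg: "(k x - k (- x)) * \<eta> x \<ge> 0" if "x > 0" "x \<noteq> 2 * \<alpha>" for x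
    using k1[of x] k2[of x] sign[of x] that by (cases "x < 2 * \<alpha>") (auto simp: zero_le_mult_iff)
  have nonneg: "(k x - k (- x)) * \<eta> x \<ge> 0" if "\<bar>x\<bar> \<noteq> 2 * \<alpha>" for x
  proof (cases "x > 0")
    case True
    then show ?thesis using that pos_nonneg by simp
  next
    case False
    then consider "x = 0" | "- x > 0" "- x \<noteq> 2 * \<alpha>" using \<open>\<bar>x\<bar> \<noteq> 2 * \<alpha>\<close> by linarith
    then show ?thesis
    proof cases
      case 2
      from pos_nonneg[OF this] show ?thesis by (simp add: odd algebra_simps)
    qed simp
  qed
  \<comment> \<open>The hypothesis on \<open>\<eta>\<close> says nothing about its sign at the mean
    itself, so this point and its reflection are discarded as null.\<close>
  have AE: "AE x in lborel. x \<notin> {0, 2 * \<alpha>, - 2 * \<alpha>}"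
    by (intro AE_lborel_singleton AE_not_in) (auto intro!: finite_imp_null_set_lborel)
  then have AE': "AE x in lborel. 0 \<le> (k x - k (- x)) * \<eta> x"
    by eventually_elim (rule nonneg, auto)
  then show ge: "(\<integral>x. \<eta> x \<partial>centered_gamma \<alpha>) \<ge> 0"
    using integral_nonneg_AE[OF AE'] eq by simp
  show "(\<integral>x. \<eta> x \<partial>centered_gamma \<alpha>) > 0" if nz: "\<And>x. x > 0 \<Longrightarrow> x \<noteq> 2 * \<alpha> \<Longrightarrow> \<eta> x \<noteq> 0"
  proof (rule ccontr)
    \<comment> \<open>A zero integral of a nonnegative integrand forces it to vanish almost
      everywhere. Beyond the mean both factors are nonzero, so a half-line would be null.\<close>
    assume "\<not> ?thesis"
    with ge eq have "(\<integral>x. (k x - k (- x)) * \<eta> x \<partial>lborel) = 0" by simp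
    then have "AE x in lborel. (k x - k (- x)) * \<eta> x = 0"
      using int1 int2 AE' by (subst (asm) integral_nonneg_eq_0_iff_AE) (auto simp: left_diff_distrib)
    with AE have "AE x in lborel. (x::real) \<le> 2 * \<alpha>"
    proof eventually_elim
      case (elim x)
      then show ?case using k2[of x] nz[of x] \<alpha> by (cases "x > 2 * \<alpha>") auto
    qed
    then have "emeasure lborel {2 * \<alpha><..} = 0"
      by (subst (asm) AE_iff_measurable[of "{2 * \<alpha><..}"]) (auto simp: not_le)
    moreover have "emeasure lborel {2 * \<alpha><..2 * \<alpha> + 1} \<le> emeasure lborel {2 * \<alpha><..}"
      by (intro emeasure_mono) auto
    ultimately show False by simp
  qed
qed

subsection \<open>Comparing the sum and the difference of independent centered Gamma variables\<close>

lemma abs_powr_gap_le: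
  assumes "p \<ge> 0"
  shows "\<bar>powr_gap p x y\<bar> \<le> 2 powr p * (\<bar>x\<bar> powr p + \<bar>y\<bar> powr p)"
proof -
  have "0 \<le> \<bar>x + y\<bar> powr p" "0 \<le> \<bar>x - y\<bar> powr p" by simp_all
  moreover have "\<bar>x - y\<bar> powr p \<le> 2 powr p * (\<bar>x\<bar> powr p + \<bar>y\<bar> powr p)"
    using abs_add_powr_le[OF assms, of x "- y"] by simp
  ultimately show ?thesis
    using abs_add_powr_le[OF assms, of x y] unfolding powr_gap_def by linarith
qed

lemma integrable_powr_gap:
  assumes "b \<ge> 0" "p \<ge> 0"
  shows "integrable (centered_gamma b) (\<lambda>y. powr_gap p x y)"
proof (rule Bochner_Integration.integrable_bound)
  interpret prob_space "centered_gamma b" using assms by (intro prob_space_centered_gamma)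
  show "integrable (centered_gamma b) (\<lambda>y. 2 powr p * (\<bar>x\<bar> powr p + \<bar>y\<bar> powr p))"
    using integrable_centered_gamma_powr[OF assms] by auto
  show "AE y in centered_gamma b. norm (powr_gap p x y) \<le> norm (2 powr p * (\<bar>x\<bar> powr p + \<bar>y\<bar> powr p))"
    using abs_powr_gap_le[OF \<open>p \<ge> 0\<close>, of x] by (auto intro: order_trans)
qed measurable

lemma integrable_pair_centered_gamma_powr:
  assumes "a \<ge> 0" "b \<ge> 0" "p \<ge> 0"
  shows "integrable (centered_gamma a \<Otimes>\<^sub>M centered_gamma b) (\<lambda>(x, y). \<bar>x\<bar> powr p + \<bar>y\<bar> powr p)"
proof -
  interpret A: prob_space "centered_gamma a" using assms by (intro prob_space_centered_gamma)
  interpret B: prob_space "centered_gamma b" using assms by (intro prob_space_centered_gamma)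
  interpret pair_prob_space "centered_gamma a" "centered_gamma b" ..
  note [simp] = integrable_centered_gamma_powr[OF \<open>a \<ge> 0\<close> \<open>p \<ge> 0\<close>]
    integrable_centered_gamma_powr[OF \<open>b \<ge> 0\<close> \<open>p \<ge> 0\<close>]
  show ?thesis
    by (rule Fubini_integrable) (auto simp: B.prob_space)
qed

lemma integrable_pair_powr_add_diff:
  assumes "a \<ge> 0" "b \<ge> 0" "p \<ge> 0"
  shows "integrable (centered_gamma a \<Otimes>\<^sub>M centered_gamma b) (\<lambda>(x, y). \<bar>x + y\<bar> powr p)"
    and "integrable (centered_gamma a \<Otimes>\<^sub>M centered_gamma b) (\<lambda>(x, y). \<bar>x - y\<bar> powr p)"
proof -
  have int: "integrable (centered_gamma a \<Otimes>\<^sub>M centered_gamma b)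
      (\<lambda>z. 2 powr p * (case z of (x, y) \<Rightarrow> \<bar>x\<bar> powr p + \<bar>y\<bar> powr p))"
    using integrable_pair_centered_gamma_powr[OF assms] by simp
  show "integrable (centered_gamma a \<Otimes>\<^sub>M centered_gamma b) (\<lambda>(x, y). \<bar>x + y\<bar> powr p)"
    by (rule Bochner_Integration.integrable_bound[OF int])
       (use abs_add_powr_le[OF \<open>p \<ge> 0\<close>] in auto)
  show "integrable (centered_gamma a \<Otimes>\<^sub>M centered_gamma b) (\<lambda>(x, y). \<bar>x - y\<bar> powr p)"
    by (rule Bochner_Integration.integrable_bound[OF int])
       (use abs_add_powr_le[OF \<open>p \<ge> 0\<close>, of _ "- y" for y] in auto)
qed

lemma integral_powr_gap:
  fixes a b p :: real
  assumes ab: "0 < a" "a \<le> 1" "0 < b" "b \<le> 1" and p: "p \<ge> 4"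
  shows "(\<integral>x. \<integral>y. powr_gap p x y \<partial>centered_gamma b \<partial>centered_gamma a) \<ge> 0"
    and "p > 4 \<Longrightarrow> (\<integral>x. \<integral>y. powr_gap p x y \<partial>centered_gamma b \<partial>centered_gamma a) > 0"
proof -
  define m where "m = 2 * a"
  define n where "n = 2 * b"
  have mn: "m > 0" "n > 0" using ab by (auto simp: m_def n_def)
  interpret A: prob_space "centered_gamma a" using ab by (intro prob_space_centered_gamma) auto
  interpret B: prob_space "centered_gamma b" using ab by (intro prob_space_centered_gamma) auto
  interpret pair_prob_space "centered_gamma a" "centered_gamma b" ..
  define \<Psi> where "\<Psi> x = (\<integral>y. powr_gap p x y \<partial>centered_gamma b)" for x
  \<comment> \<open>\<open>Q\<close> is the remainder integrated over \<open>y\<close>: its part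
    linear in \<open>y\<close> has mean zero and drops out.\<close>
  define Q where "Q x = n * (m * \<Psi> x - x * \<Psi> m)" for x
  note X = has_bochner_integral_centered_gamma[OF \<open>0 < a\<close>, unfolded has_bochner_integral_iff]
  note Y = has_bochner_integral_centered_gamma[OF \<open>0 < b\<close>, unfolded has_bochner_integral_iff]
  have gap [simp]: "integrable (centered_gamma b) (\<lambda>y. powr_gap p x y)" for x
    using ab p by (intro integrable_powr_gap) auto
  have rem_int: "integrable (centered_gamma b) (\<lambda>y. gap_remainder p m n x y)" for x
    using Y unfolding gap_remainder_def by auto
  have rem: "(\<integral>y. gap_remainder p m n x y \<partial>centered_gamma b) = Q x" for x
    using Y unfolding gap_remainder_def Q_def \<Psi>_def by simp
  have "integrable (centered_gamma a \<Otimes>\<^sub>M centered_gamma b) (\<lambda>(x, y). powr_gap p x y)"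
    using Bochner_Integration.integrable_diff[OF integrable_pair_powr_add_diff[of a b p]] ab p
    by (simp add: powr_gap_def case_prod_unfold)
  then have \<Psi>_int: "integrable (centered_gamma a) \<Psi>"
    unfolding \<Psi>_def by (rule integrable_fst)
  have Q_int: "integrable (centered_gamma a) Q"
    using \<Psi>_int X unfolding Q_def by auto
  \<comment> \<open>The part of \<open>Q\<close> linear in \<open>x\<close> has mean zero, so
    passing from \<open>\<Psi>\<close> to \<open>Q\<close> only rescales the expectation.\<close>
  have \<Psi>_eq: "(\<integral>x. \<Psi> x \<partial>centered_gamma a) = (\<integral>x. Q x \<partial>centered_gamma a) / (n * m)"
    using \<Psi>_int X mn unfolding Q_def by simp
  have odd: "Q (- x) = - Q x" for x
    by (simp add: Q_def \<Psi>_def algebra_simps)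
  \<comment> \<open>First use of the sign-change lemma, in \<open>y\<close> for fixed
    \<open>x\<close>. For \<open>x < m\<close> the sign pattern is reversed, so it is applied to the
    negated remainder.\<close>
  have strict: "Q x * (x - m) > 0" if "p > 4" "x > 0" "x \<noteq> m" for x
  proof (cases "x > m")
    case True
    have "gap_remainder p m n x y * (y - n) > 0" if "y > 0" "y \<noteq> n" for y
      using gap_remainder_pos[OF \<open>p > 4\<close> mn \<open>x > 0\<close> that(1) \<open>x \<noteq> m\<close> that(2)] True
      by (simp add: zero_less_mult_iff mult_less_0_iff)
    then have sgn: "gap_remainder p m n x y * (y - 2 * b) \<ge> 0" "y \<noteq> 2 * b \<Longrightarrow> gap_remainder p m n x y \<noteq> 0"
      if "y > 0" for y using that by (cases "y = n"; force simp: n_def)+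
    have "Q x > 0"
      unfolding rem[symmetric]
      by (rule centered_gamma_integral_sign_change(2)[OF \<open>0 < b\<close> \<open>b \<le> 1\<close> rem_int])
         (use sgn in auto)
    then show ?thesis using True by simp
  next
    case False
    with \<open>x \<noteq> m\<close> have "x < m" by simp
    have "- gap_remainder p m n x y * (y - n) > 0" if "y > 0" "y \<noteq> n" for y
      using gap_remainder_pos[OF \<open>p > 4\<close> mn \<open>x > 0\<close> that(1) \<open>x \<noteq> m\<close> that(2)] \<open>x < m\<close>
      by (auto simp add: zero_less_mult_iff mult_less_0_iff)
    then have sgn: "- gap_remainder p m n x y * (y - 2 * b) \<ge> 0" "y \<noteq> 2 * b \<Longrightarrow> - gap_remainder p m n x y \<noteq> 0"
      if "y > 0" for y using that by (cases "y = n"; force simp: n_def)+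
    have "(\<integral>y. - gap_remainder p m n x y \<partial>centered_gamma b) > 0"
      by (rule centered_gamma_integral_sign_change(2)[OF \<open>0 < b\<close> \<open>b \<le> 1\<close>])
         (use sgn rem_int in auto)
    then show ?thesis using \<open>x < m\<close> by (simp add: rem mult_neg_neg)
  qed
  have sign: "Q x * (x - 2 * a) \<ge> 0" if "x > 0" for x
  proof (cases "p = 4 \<or> x = m")
    case True
    then show ?thesis
      using rem[of x] by (auto simp: gap_remainder_4 m_def[symmetric])
  next
    case False
    then show ?thesis using strict[of x] p that by (simp add: m_def)
  qed
  \<comment> \<open>Second use, in \<open>x\<close>: \<open>Q\<close> is odd and changes sign on the
    positive axis only at the mean.\<close>
  have "(\<integral>x. Q x \<partial>centered_gamma a) \<ge> 0"
    by (rule centered_gamma_integral_sign_change(1)[OF \<open>0 < a\<close> \<open>a \<le> 1\<close> Q_int odd sign])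
  then show "(\<integral>x. \<integral>y. powr_gap p x y \<partial>centered_gamma b \<partial>centered_gamma a) \<ge> 0"
    using mn by (simp add: \<Psi>_eq flip: \<Psi>_def)
  assume "p > 4"
  have "(\<integral>x. Q x \<partial>centered_gamma a) > 0"
    by (rule centered_gamma_integral_sign_change(2)[OF \<open>0 < a\<close> \<open>a \<le> 1\<close> Q_int odd sign])
       (use strict[OF \<open>p > 4\<close>] in \<open>force simp: m_def\<close>)+
  then show "(\<integral>x. \<integral>y. powr_gap p x y \<partial>centered_gamma b \<partial>centered_gamma a) > 0"
    using mn by (simp add: \<Psi>_eq flip: \<Psi>_def)
qed

section \<open>Reduction of the moments of the difference to those of the sum\<close>

lemma pair_centered_gamma:
  assumes "a \<ge> 0" "b \<ge> 0"
  shows "centered_gamma a \<Otimes>\<^sub>M centered_gamma b =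
    distr (gamma_distribution a (1 / 2) \<Otimes>\<^sub>M gamma_distribution b (1 / 2)) (borel \<Otimes>\<^sub>M borel)
      (\<lambda>(x, y). (x - 2 * a, y - 2 * b))"
proof -
  have "sigma_finite_measure (centered_gamma b)"
    by (intro prob_space_imp_sigma_finite prob_space_centered_gamma assms)
  then show ?thesis
    unfolding centered_gamma_def by (intro pair_measure_distr) simp_all
qed

lemma convolution_centered_gamma:
  assumes "a \<ge> 0" "b \<ge> 0"
  shows "centered_gamma a \<star> centered_gamma b = centered_gamma (a + b)"
proof -
  have "centered_gamma a \<star> centered_gamma b =
      distr (gamma_distribution a (1 / 2) \<Otimes>\<^sub>M gamma_distribution b (1 / 2)) borel
        (\<lambda>z. (fst z - 2 * a) + (snd z - 2 * b))"
    by (simp add: convolution_def pair_centered_gamma assms distr_distr comp_def case_prod_unfold)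
  also have "\<dots> = distr (gamma_distribution a (1 / 2) \<star> gamma_distribution b (1 / 2)) borel
        (\<lambda>x. x - 2 * (a + b))"
    by (simp add: convolution_def distr_distr comp_def case_prod_beta algebra_simps)
  also have "\<dots> = centered_gamma (a + b)"
    using assms by (simp add: convolution_gamma_distribution centered_gamma_def)
  finally show ?thesis .
qed

text \<open>The sum \<open>x + y\<close> has the law \<open>centered_gamma (a + b)\<close>, and
  subtracting the gap turns its moment into that of \<open>x - y\<close>; Fubini makes the gap term
  an iterated integral.\<close>

lemma integral_abs_diff_powr:
  assumes "a \<ge> 0" "b \<ge> 0" "p \<ge> 0"
  shows "(\<integral>(x, y). \<bar>x - y\<bar> powr p \<partial>(centered_gamma a \<Otimes>\<^sub>M centered_gamma b)) =
    (\<integral>z. \<bar>z\<bar> powr p \<partial>centered_gamma (a + b)) -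
    (\<integral>x. \<integral>y. powr_gap p x y \<partial>centered_gamma b \<partial>centered_gamma a)"
proof -
  interpret A: prob_space "centered_gamma a" using assms by (intro prob_space_centered_gamma)
  interpret B: prob_space "centered_gamma b" using assms by (intro prob_space_centered_gamma)
  interpret pair_prob_space "centered_gamma a" "centered_gamma b" ..
  note int = integrable_pair_powr_add_diff[OF assms]
  have gap_eq: "(\<lambda>(x, y). powr_gap p x y) =
      (\<lambda>z. (case z of (x, y) \<Rightarrow> \<bar>x + y\<bar> powr p) - (case z of (x, y) \<Rightarrow> \<bar>x - y\<bar> powr p))"
    by (auto simp: powr_gap_def)
  have gap_int: "integrable (centered_gamma a \<Otimes>\<^sub>M centered_gamma b) (\<lambda>(x, y). powr_gap p x y)"
    unfolding gap_eq using int by (rule Bochner_Integration.integrable_diff)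
  have "(\<integral>z. \<bar>z\<bar> powr p \<partial>centered_gamma (a + b)) =
      (\<integral>(x, y). \<bar>x + y\<bar> powr p \<partial>(centered_gamma a \<Otimes>\<^sub>M centered_gamma b))"
    using assms
    by (simp add: convolution_centered_gamma[symmetric] convolution_def integral_distr)
       (simp add: case_prod_unfold)
  moreover have "(\<integral>x. \<integral>y. powr_gap p x y \<partial>centered_gamma b \<partial>centered_gamma a) =
      (\<integral>(x, y). powr_gap p x y \<partial>(centered_gamma a \<Otimes>\<^sub>M centered_gamma b))"
    by (rule integral_fst[OF gap_int])
  moreover have "(\<integral>(x, y). powr_gap p x y \<partial>(centered_gamma a \<Otimes>\<^sub>M centered_gamma b)) =
      (\<integral>(x, y). \<bar>x + y\<bar> powr p \<partial>(centered_gamma a \<Otimes>\<^sub>M centered_gamma b)) -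
      (\<integral>(x, y). \<bar>x - y\<bar> powr p \<partial>(centered_gamma a \<Otimes>\<^sub>M centered_gamma b))"
    unfolding gap_eq using int by (rule Bochner_Integration.integral_diff)
  ultimately show ?thesis by simp
qed

subsection \<open>The square of a standard normal variable\<close>

text \<open>The substitution is made on \<open>{0..real i}\<close>, and \<open>i\<close> tends to
  infinity by monotone convergence.\<close>

lemma nn_integral_square_substitution:
  assumes [measurable]: "f \<in> borel_measurable borel"
  shows "(\<integral>\<^sup>+y. f y * indicator {0..} y \<partial>lborel) =
    (\<integral>\<^sup>+x. f (x\<^sup>2) * ennreal (2 * x) * indicator {0..} x \<partial>lborel)"
proof -
  have lim1: "(\<lambda>i. \<integral>\<^sup>+y. f y * indicator {0..(real i)\<^sup>2} y \<partial>lborel) \<longlonglongrightarrow> (\<integral>\<^sup>+y. f y * indicator {0..} y \<partial>lborel)"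
  proof (rule nn_integral_LIMSEQ)
    show "incseq (\<lambda>i y. f y * indicator {0..(real i)\<^sup>2} y)"
      by (auto simp: incseq_def le_fun_def indicator_def intro: order_trans power_mono)
    show "(\<lambda>i. f y * indicator {0..(real i)\<^sup>2} y) \<longlonglongrightarrow> f y * indicator {0..} y" for y
    proof (rule tendsto_eventually)
      \<comment> \<open>The bound 1 ensures that \<open>real i\<close> is at most its square, which
        then exceeds \<open>y\<close>.\<close>
      have "\<forall>\<^sub>F i in sequentially. real i \<ge> max 1 y"
        using filterlim_real_sequentially unfolding filterlim_at_top by blast
      then show "\<forall>\<^sub>F i in sequentially. f y * indicator {0..(real i)\<^sup>2} y = f y * indicator {0..} y"
      proof eventually_elim
        case (elim i)
        then have "y \<le> (real i)\<^sup>2" using self_le_power[of "real i" 2] by linarith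
        then show ?case by (simp add: indicator_def)
      qed
    qed
  qed measurable
  have lim2: "(\<lambda>i. \<integral>\<^sup>+x. f (x\<^sup>2) * ennreal (2 * x) * indicator {0..real i} x \<partial>lborel) \<longlonglongrightarrow>
      (\<integral>\<^sup>+x. f (x\<^sup>2) * ennreal (2 * x) * indicator {0..} x \<partial>lborel)"
  proof (rule nn_integral_LIMSEQ)
    show "incseq (\<lambda>i x. f (x\<^sup>2) * ennreal (2 * x) * indicator {0..real i} x)"
      by (auto simp: incseq_def le_fun_def indicator_def)
    show "(\<lambda>i. f (x\<^sup>2) * ennreal (2 * x) * indicator {0..real i} x) \<longlonglongrightarrow>
        f (x\<^sup>2) * ennreal (2 * x) * indicator {0..} x" for x
    proof (rule tendsto_eventually)
      have "\<forall>\<^sub>F i in sequentially. real i \<ge> x"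
        using filterlim_real_sequentially by (simp add: filterlim_at_top)
      then show "\<forall>\<^sub>F i in sequentially. f (x\<^sup>2) * ennreal (2 * x) * indicator {0..real i} x =
          f (x\<^sup>2) * ennreal (2 * x) * indicator {0..} x"
        by eventually_elim (simp add: indicator_def)
    qed
  qed measurable
  have "(\<integral>\<^sup>+y. f y * indicator {0..(real i)\<^sup>2} y \<partial>lborel) =
      (\<integral>\<^sup>+x. f (x\<^sup>2) * ennreal (2 * x) * indicator {0..real i} x \<partial>lborel)" if "i > 0" for i :: nat
  proof -
    have "((\<lambda>x. x\<^sup>2) has_real_derivative 2 * x) (at x)" for x :: real
      by (auto intro!: derivative_eq_intros)
    with nn_integral_substitution_aux[of f 0 "real i" "\<lambda>x. x\<^sup>2" "\<lambda>x. 2 * x"] that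
    show ?thesis by (auto intro!: continuous_intros)
  qed
  then have eq: "\<forall>\<^sub>F i in sequentially. (\<integral>\<^sup>+y. f y * indicator {0..(real i)\<^sup>2} y \<partial>lborel) =
      (\<integral>\<^sup>+x. f (x\<^sup>2) * ennreal (2 * x) * indicator {0..real i} x \<partial>lborel)"
    by (rule eventually_mono[OF eventually_gt_at_top[of 0]])
  show ?thesis
    by (rule LIMSEQ_unique[OF lim1 tendsto_cong[OF eq, THEN iffD2, OF lim2]])
qed

lemma nn_integral_even:
  fixes f :: "real \<Rightarrow> ennreal"
  assumes [measurable]: "f \<in> borel_measurable borel" and even: "\<And>x. f (- x) = f x"
  shows "(\<integral>\<^sup>+x. f x \<partial>lborel) = 2 * (\<integral>\<^sup>+x. f x * indicator {0..} x \<partial>lborel)"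
proof -
  have "(\<integral>\<^sup>+x. f x \<partial>lborel) = (\<integral>\<^sup>+x. f x * indicator {0..} x + f x * indicator {..0} x \<partial>lborel)"
    by (intro nn_integral_cong_AE, use AE_lborel_singleton[of "0::real"] in eventually_elim)
       (auto simp: indicator_def)
  also have "\<dots> = (\<integral>\<^sup>+x. f x * indicator {0..} x \<partial>lborel) + (\<integral>\<^sup>+x. f x * indicator {..0} x \<partial>lborel)"
    by (intro nn_integral_add) auto
  also have "(\<integral>\<^sup>+x. f x * indicator {..0} x \<partial>lborel) = (\<integral>\<^sup>+x. f x * indicator {0..} x \<partial>lborel)"
    by (subst nn_integral_real_affine[of _ "-1" 0]) (auto simp: even indicator_def)
  finally show ?thesis by (simp add: mult_2)
qed

lemma (in prob_space) distr_square_std_normal: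
  assumes "distributed M lborel g std_normal_density"
  shows "distr M borel (\<lambda>\<omega>. (g \<omega>)\<^sup>2) = gamma_distribution (1 / 2) (1 / 2)"
proof (rule measure_eqI)
  fix S assume "S \<in> sets (distr M borel (\<lambda>\<omega>. (g \<omega>)\<^sup>2))"
  then have [measurable]: "S \<in> sets borel" by simp
  have g: "distr M lborel g = density lborel std_normal_density"
    using assms by (rule distributed_distr_eq_density)
  have g_meas [measurable]: "g \<in> borel_measurable M"
    using distributed_measurable[OF assms] by simp
  \<comment> \<open>The Jacobian \<open>2 * x\<close> stands on the left; the factor 2 on the right
    accounts for the two square roots of each positive value.\<close>
  have dens: "gamma_density (1 / 2) (1 / 2) (x\<^sup>2) * (2 * x) = 2 * std_normal_density x" if "x > 0" for x
    using that by (simp add: gamma_density_def std_normal_density_def powr_half_sqrt powr_minus_divide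
      Gamma_one_half_real real_sqrt_mult real_sqrt_divide exp_minus field_simps)
  have "emeasure (distr M borel (\<lambda>\<omega>. (g \<omega>)\<^sup>2)) S = emeasure (distr (distr M lborel g) borel (\<lambda>x. x\<^sup>2)) S"
    by (simp add: distr_distr comp_def)
  also have "\<dots> = (\<integral>\<^sup>+x. ennreal (std_normal_density x) * indicator S (x\<^sup>2) \<partial>lborel)"
    unfolding g
    using measurable_sets_borel[of "\<lambda>x::real. x\<^sup>2" borel S]
    by (simp add: emeasure_distr emeasure_density indicator_def)
  also have "\<dots> = 2 * (\<integral>\<^sup>+x. ennreal (std_normal_density x) * indicator S (x\<^sup>2) * indicator {0..} x \<partial>lborel)"
    by (intro nn_integral_even) (auto simp: std_normal_density_def)
  also have "\<dots> = (\<integral>\<^sup>+x. (ennreal (gamma_density (1 / 2) (1 / 2) (x\<^sup>2)) * indicator S (x\<^sup>2)) *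
      ennreal (2 * x) * indicator {0..} x \<partial>lborel)"
  proof (subst nn_integral_cmult[symmetric], measurable,
      intro nn_integral_cong_AE, use AE_lborel_singleton[of "0::real"] in eventually_elim)
    fix x :: real
    assume "x \<noteq> 0"
    then show "2 * (ennreal (std_normal_density x) * indicator S (x\<^sup>2) * indicator {0..} x) =
        ennreal (gamma_density (1 / 2) (1 / 2) (x\<^sup>2)) * indicator S (x\<^sup>2) * ennreal (2 * x) * indicator {0..} x"
      using arg_cong[OF dens[of x], of ennreal]
      by (cases "x > 0") (auto simp: indicator_def ennreal_mult)
  qed
  also have "\<dots> = (\<integral>\<^sup>+y. (ennreal (gamma_density (1 / 2) (1 / 2) y) * indicator S y) * indicator {0..} y \<partial>lborel)"
    by (subst nn_integral_square_substitution) auto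
  also have "\<dots> = (\<integral>\<^sup>+y. ennreal (gamma_density (1 / 2) (1 / 2) y) * indicator S y \<partial>lborel)"
    by (intro nn_integral_cong) (auto simp: indicator_def gamma_density_def)
  also have "\<dots> = emeasure (gamma_distribution (1 / 2) (1 / 2)) S"
    by (simp add: gamma_distribution_def emeasure_density)
  finally show "emeasure (distr M borel (\<lambda>\<omega>. (g \<omega>)\<^sup>2)) S = emeasure (gamma_distribution (1 / 2) (1 / 2)) S" .
qed simp

subsection \<open>Moments of Gamma differences\<close>

lemma centered_gamma_difference_distr:
  assumes "centered_gamma_difference M \<delta> Z"
  shows "Z \<in> borel_measurable M"
    and "distr M borel Z =
      distr (centered_gamma ((1 + \<delta>) / 4) \<Otimes>\<^sub>M centered_gamma ((1 - \<delta>) / 4)) borel (\<lambda>(x, y). x - y)"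
proof -
  interpret prob_space M using assms by (simp add: centered_gamma_difference_def)
  have \<delta>: "-1 \<le> \<delta>" "\<delta> \<le> 1" using assms by (simp_all add: centered_gamma_difference_def)
  obtain A B where ind: "indep_var borel A borel B"
    and A: "distr M borel A = gamma_distribution ((1 + \<delta>) / 4) (1 / 2)"
    and B: "distr M borel B = gamma_distribution ((1 - \<delta>) / 4) (1 / 2)"
    and Z: "Z = (\<lambda>\<omega>. A \<omega> - B \<omega> - \<delta>)"
    using assms by (auto simp: centered_gamma_difference_def)
  have [measurable]: "A \<in> borel_measurable M" "B \<in> borel_measurable M"
    using indep_var_rv1[OF ind] indep_var_rv2[OF ind] by auto
  show "Z \<in> borel_measurable M" unfolding Z by measurable
  have AB: "distr M (borel \<Otimes>\<^sub>M borel) (\<lambda>\<omega>. (A \<omega>, B \<omega>)) =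
      gamma_distribution ((1 + \<delta>) / 4) (1 / 2) \<Otimes>\<^sub>M gamma_distribution ((1 - \<delta>) / 4) (1 / 2)"
    using ind by (simp add: indep_var_distribution_eq A B)
  \<comment> \<open>The means of \<open>A\<close> and \<open>B\<close> are (1 + \<delta>) / 2 and (1
    - \<delta>) / 2; their difference is the subtracted \<delta>.\<close>
  have "Z = (\<lambda>\<omega>. (A \<omega> - 2 * ((1 + \<delta>) / 4)) - (B \<omega> - 2 * ((1 - \<delta>) / 4)))"
    by (auto simp: Z field_simps)
  then show "distr M borel Z =
      distr (centered_gamma ((1 + \<delta>) / 4) \<Otimes>\<^sub>M centered_gamma ((1 - \<delta>) / 4)) borel (\<lambda>(x, y). x - y)"
    using \<delta> by (simp add: pair_centered_gamma AB[symmetric] distr_distr comp_def)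
qed

text \<open>The two shapes add up to 1/2 for every \<delta>, so only the gap term depends on
  \<delta>.\<close>

lemma centered_gamma_difference_moment:
  assumes Z: "centered_gamma_difference M \<delta> Z" and p: "p \<ge> 0"
  shows "integrable M (\<lambda>\<omega>. \<bar>Z \<omega>\<bar> powr p)"
    and "(\<integral>\<omega>. \<bar>Z \<omega>\<bar> powr p \<partial>M) = (\<integral>z. \<bar>z\<bar> powr p \<partial>centered_gamma (1 / 2)) -
      (\<integral>x. \<integral>y. powr_gap p x y \<partial>centered_gamma ((1 - \<delta>) / 4) \<partial>centered_gamma ((1 + \<delta>) / 4))"
proof -
  note [measurable] = centered_gamma_difference_distr(1)[OF Z]
  note D = centered_gamma_difference_distr(2)[OF Z]
  have \<delta>: "(1 + \<delta>) / 4 \<ge> 0" "(1 - \<delta>) / 4 \<ge> 0" "(1 + \<delta>) / 4 + (1 - \<delta>) / 4 = 1 / 2"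
    using Z by (simp_all add: centered_gamma_difference_def field_simps)
  have "integrable (distr M borel Z) (\<lambda>z. \<bar>z\<bar> powr p)"
    unfolding D using integrable_pair_powr_add_diff(2)[OF \<delta>(1,2) p]
    by (subst integrable_distr_eq) (auto simp: case_prod_unfold)
  then show "integrable M (\<lambda>\<omega>. \<bar>Z \<omega>\<bar> powr p)"
    by (simp add: integrable_distr_eq)
  have "(\<integral>\<omega>. \<bar>Z \<omega>\<bar> powr p \<partial>M) = (\<integral>z. \<bar>z\<bar> powr p \<partial>distr M borel Z)"
    by (simp add: integral_distr)
  also have "\<dots> = (\<integral>(x, y). \<bar>x - y\<bar> powr p \<partial>(centered_gamma ((1 + \<delta>) / 4) \<Otimes>\<^sub>M centered_gamma ((1 - \<delta>) / 4)))"
    unfolding D by (simp add: integral_distr case_prod_unfold)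
  finally show "(\<integral>\<omega>. \<bar>Z \<omega>\<bar> powr p \<partial>M) = (\<integral>z. \<bar>z\<bar> powr p \<partial>centered_gamma (1 / 2)) -
      (\<integral>x. \<integral>y. powr_gap p x y \<partial>centered_gamma ((1 - \<delta>) / 4) \<partial>centered_gamma ((1 + \<delta>) / 4))"
    using integral_abs_diff_powr[OF \<delta>(1,2) p] by (simp add: \<delta>(3))
qed

theorem theorem3p3:
  fixes M :: "'a measure" and M\<^sub>1 :: "'b measure" and N :: "'c measure"
    and Z :: "'a \<Rightarrow> real" and Z\<^sub>1 :: "'b \<Rightarrow> real" and g :: "'c \<Rightarrow> real"
    and p \<delta> :: real
  assumes "prob_space N" and "distributed N lborel g std_normal_density"
    and "centered_gamma_difference M \<delta> Z"
    and "centered_gamma_difference M\<^sub>1 1 Z\<^sub>1"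
    and "4 \<le> p" and "0 \<le> \<delta>" and "\<delta> \<le> 1"
  shows "integrable M (\<lambda>\<omega>. \<bar>Z \<omega>\<bar> powr p) \<and>
         integrable M\<^sub>1 (\<lambda>\<omega>. \<bar>Z\<^sub>1 \<omega>\<bar> powr p) \<and>
         integrable N (\<lambda>\<omega>. \<bar>(g \<omega>)\<^sup>2 - 1\<bar> powr p) \<and>
         prob_space.expectation M (\<lambda>\<omega>. \<bar>Z \<omega>\<bar> powr p) \<le>
         prob_space.expectation M\<^sub>1 (\<lambda>\<omega>. \<bar>Z\<^sub>1 \<omega>\<bar> powr p) \<and>
         prob_space.expectation M\<^sub>1 (\<lambda>\<omega>. \<bar>Z\<^sub>1 \<omega>\<bar> powr p) =
         prob_space.expectation N (\<lambda>\<omega>. \<bar>(g \<omega>)\<^sup>2 - 1\<bar> powr p) \<and>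
         (p > 4 \<and> \<delta> < 1 \<longrightarrow>
         prob_space.expectation M (\<lambda>\<omega>. \<bar>Z \<omega>\<bar> powr p) <
         prob_space.expectation M\<^sub>1 (\<lambda>\<omega>. \<bar>Z\<^sub>1 \<omega>\<bar> powr p))"
proof -
  have p: "p \<ge> 0" using assms by simp
  interpret N: prob_space N by fact
  note Z = centered_gamma_difference_moment[OF assms(3) p]
  note Z1 = centered_gamma_difference_moment[OF assms(4) p]
  have [measurable]: "g \<in> borel_measurable N"
    using distributed_measurable[OF assms(2)] by simp
  have "distr N borel (\<lambda>\<omega>. (g \<omega>)\<^sup>2 - 1) = distr (distr N borel (\<lambda>\<omega>. (g \<omega>)\<^sup>2)) borel (\<lambda>x. x - 1)"
    by (simp add: distr_distr comp_def)
  also have "\<dots> = centered_gamma (1 / 2)"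
    by (simp add: N.distr_square_std_normal[OF assms(2)] centered_gamma_def)
  finally have G: "distr N borel (\<lambda>\<omega>. (g \<omega>)\<^sup>2 - 1) = centered_gamma (1 / 2)" .
  have G_int: "integrable N (\<lambda>\<omega>. \<bar>(g \<omega>)\<^sup>2 - 1\<bar> powr p)"
    using integrable_centered_gamma_powr[of "1 / 2" p] p
    by (simp add: G[symmetric] integrable_distr_eq)
  have G_eq: "(\<integral>\<omega>. \<bar>(g \<omega>)\<^sup>2 - 1\<bar> powr p \<partial>N) = (\<integral>z. \<bar>z\<bar> powr p \<partial>centered_gamma (1 / 2))"
    by (simp add: G[symmetric] integral_distr)
  \<comment> \<open>For \<delta> = 1 the second shape is 0, hence \<open>y = 0\<close> and the gap
    vanishes.\<close>
  have Z1_eq: "(\<integral>\<omega>. \<bar>Z\<^sub>1 \<omega>\<bar> powr p \<partial>M\<^sub>1) = (\<integral>z. \<bar>z\<bar> powr p \<partial>centered_gamma (1 / 2))"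
    by (simp add: Z1(2) centered_gamma_0 integral_return)
  have le: "(\<integral>\<omega>. \<bar>Z \<omega>\<bar> powr p \<partial>M) \<le> (\<integral>\<omega>. \<bar>Z\<^sub>1 \<omega>\<bar> powr p \<partial>M\<^sub>1)"
  \<comment> \<open>The sign argument needs both shapes positive, so the endpoint is treated
    apart.\<close>
  proof (cases "\<delta> = 1")
    case True
    then show ?thesis using Z(2) Z1(2) by simp
  next
    case False
    then show ?thesis
      unfolding Z1_eq Z(2) using integral_powr_gap(1)[of "(1 + \<delta>) / 4" "(1 - \<delta>) / 4" p] assms by simp
  qed
  have less: "(\<integral>\<omega>. \<bar>Z \<omega>\<bar> powr p \<partial>M) < (\<integral>\<omega>. \<bar>Z\<^sub>1 \<omega>\<bar> powr p \<partial>M\<^sub>1)" if "p > 4" "\<delta> < 1"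
    unfolding Z1_eq Z(2) using integral_powr_gap(2)[of "(1 + \<delta>) / 4" "(1 - \<delta>) / 4" p] assms that by simp
  show ?thesis
    using Z(1) Z1(1) G_int G_eq Z1_eq le less by simp
qed

end
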